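(* There exists a non-trivial dynamical system $(X,T)$ (that is, $X$ has at least two points) such that $(x,y)$ is $(r,s)$-scrambled for any two distinct points $x,y\in X$ and any $r,s\in\mathbb{N}$.
   Context: A dynamical system $(X,T)$ is a compact metric space $(X,\rho)$ with a continuous map $T\colon X\to X$. $\mathbb{N}$ is the set of positive integers. For $r,s\in\mathbb{N}$, a pair $(x,y)\in X\times X$ is $(r,s)$-scrambled if $\liminf_{n\to\infty}\rho(T^{rn}x,T^{sn}y)=0$ and $\limsup_{n\to\infty}\rho(T^{rn}x,T^{sn}y)>0$. *)

theory Defs
  imports "HOL-Analysis.Analysis"
begin

definition dynamical_system :: "'a set \<Rightarrow> ('a \<Rightarrow> 'a \<Rightarrow> real) \<Rightarrow> ('a \<Rightarrow> 'a) \<Rightarrow> bool" where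
  "dynamical_system X \<rho> T \<longleftrightarrow>
     Metric_space X \<rho> \<and>
     compact_space (Metric_space.mtopology X \<rho>) \<and>
     continuous_map (Metric_space.mtopology X \<rho>) (Metric_space.mtopology X \<rho>) T"

text \<open>The limits are taken in \<^typ>\<open>ereal\<close>, a complete lattice, so that
  \<^const>\<open>liminf\<close> and \<^const>\<open>limsup\<close> are always well defined.\<close>

definition scrambled ::
    "('a \<Rightarrow> 'a \<Rightarrow> real) \<Rightarrow> ('a \<Rightarrow> 'a) \<Rightarrow> nat \<Rightarrow> nat \<Rightarrow> 'a \<Rightarrow> 'a \<Rightarrow> bool" where
  "scrambled \<rho> T r s x y \<longleftrightarrow>
     liminf (\<lambda>n. ereal (\<rho> ((T ^^ (r * n)) x) ((T ^^ (s * n)) y))) = 0 \<and>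
     limsup (\<lambda>n. ereal (\<rho> ((T ^^ (r * n)) x) ((T ^^ (s * n)) y))) > 0"

text \<open>HOL cannot quantify existentially over types, so an existence statement about
  dynamical systems has to fix a type containing the carrier. The lemmas below show that
  \<^typ>\<open>nat \<Rightarrow> real\<close> is large enough: every dynamical system, over any type, has an
  isometric conjugate copy whose carrier is a subset of \<^typ>\<open>nat \<Rightarrow> real\<close>.\<close>

lemma compact_metric_inj:
  fixes X :: "'a set"
  assumes "Metric_space X \<rho>" "compact_space (Metric_space.mtopology X \<rho>)"
  obtains f :: "'a \<Rightarrow> nat \<Rightarrow> real" where "inj_on f X"
proof (cases "X = {}")
  case True
  then show ?thesis using that by (metis inj_on_empty)
next
  case False
  interpret Metric_space X \<rho> by fact
  have "mtotally_bounded X"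
    using assms(2) compact_space_eq_mcomplete_mtotally_bounded by blast
  then have "\<exists>K. finite K \<and> K \<subseteq> X \<and> X \<subseteq> (\<Union>x\<in>K. mball x (1 / Suc n))" for n
    unfolding mtotally_bounded_def by (metis of_nat_0_less_iff zero_less_Suc zero_less_divide_1_iff)
  then obtain K where K: "\<And>n. finite (K n)" "\<And>n. K n \<subseteq> X"
      "\<And>n. X \<subseteq> (\<Union>x\<in>K n. mball x (1 / Suc n))"
    by metis
  define D where "D = (\<Union>n. K n)"
  have "countable D" unfolding D_def by (intro countable_UN) (auto intro: countable_finite K)
  moreover have DX: "D \<subseteq> X" using K(2) by (auto simp: D_def)
  moreover have "D \<noteq> {}" using False K(3)[of 0] by (auto simp: D_def)
  ultimately obtain e :: "nat \<Rightarrow> 'a" where e: "D = range e"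
    using uncountable_def by blast
  have "inj_on (\<lambda>x n. \<rho> x (e n)) X"
  proof (rule inj_onI, rule ccontr)
    fix x y assume xy: "x \<in> X" "y \<in> X" and eq: "(\<lambda>n. \<rho> x (e n)) = (\<lambda>n. \<rho> y (e n))"
      and "x \<noteq> y"
    then have "\<rho> x y / 2 > 0" by simp
    then obtain n where n: "1 / Suc n < \<rho> x y / 2" using nat_approx_posE by blast
    obtain z where z: "z \<in> K n" "x \<in> mball z (1 / Suc n)" using K(3)[of n] xy by blast
    then obtain m where "z = e m" using e by (auto simp: D_def)
    then have "\<rho> x z = \<rho> y z" using eq by metis
    moreover have "\<rho> x y \<le> \<rho> x z + \<rho> z y" using z xy by (auto intro: triangle)
    ultimately show False using z n by (auto simp: commute)
  qed
  then show ?thesis using that by blast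
qed

lemma dynamical_system_copy:
  fixes X :: "'a set"
  assumes "dynamical_system X \<rho> T"
  obtains f :: "'a \<Rightarrow> nat \<Rightarrow> real" and \<rho>' T'
  where "bij_betw f X (f ` X)" "dynamical_system (f ` X) \<rho>' T'"
    "\<And>x y. x \<in> X \<Longrightarrow> y \<in> X \<Longrightarrow> \<rho>' (f x) (f y) = \<rho> x y"
    "\<And>x. x \<in> X \<Longrightarrow> T' (f x) = f (T x)"
proof -
  have M: "Metric_space X \<rho>" and C: "compact_space (Metric_space.mtopology X \<rho>)"
    and T: "continuous_map (Metric_space.mtopology X \<rho>) (Metric_space.mtopology X \<rho>) T"
    using assms by (auto simp: dynamical_system_def)
  interpret Metric_space X \<rho> by (rule M)
  obtain f :: "'a \<Rightarrow> nat \<Rightarrow> real" where f: "inj_on f X"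
    using compact_metric_inj[OF M C] .
  define g where "g = inv_into X f"
  define \<rho>' where "\<rho>' = (\<lambda>a b. \<rho> (g a) (g b))"
  define T' where "T' = f \<circ> T \<circ> g"
  have gf [simp]: "g (f x) = x" if "x \<in> X" for x using f that by (simp add: g_def)
  have gX: "g a \<in> X" if "a \<in> f ` X" for a using that by auto
  interpret N: Metric_space "f ` X" \<rho>'
    by unfold_locales (auto simp: \<rho>'_def commute triangle)
  have cf: "continuous_map mtopology N.mtopology f"
    by (subst metric_continuous_map[OF N.Metric_space_axioms]) (auto simp: \<rho>'_def)
  have cg: "continuous_map N.mtopology mtopology g"
    by (subst N.metric_continuous_map[OF M]) (auto simp: \<rho>'_def)
  have "continuous_map N.mtopology N.mtopology T'"
    unfolding T'_def by (intro continuous_map_compose[OF cg] continuous_map_compose[OF T] cf)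
  moreover have "compact_space N.mtopology"
    using image_compactin[OF C[unfolded compact_space_def] cf] by (simp add: compact_space_def)
  ultimately have "dynamical_system (f ` X) \<rho>' T'"
    using N.Metric_space_axioms by (simp add: dynamical_system_def)
  then show ?thesis
    by (rule that[rotated]) (auto simp: \<rho>'_def T'_def intro: f inj_on_imp_bij_betw)
qed

end

theory Submission
  imports Defs
begin

text \<open>If \<open>T ^^ (n\<^sub>k)\<close> tends to the identity uniformly, then so does \<open>T ^^ (r * n\<^sub>k)\<close>, whence
  \<open>\<rho> ((T ^^ (r * n\<^sub>k)) x) ((T ^^ (s * n\<^sub>k)) y) \<longlonglongrightarrow> \<rho> x y > 0\<close>.
  If moreover each point stays near a fixed point \<open>p\<close> on arbitrarily long blocks of times
  that recur with bounded gaps, then \<open>(T ^^ (r * n)) x\<close> and \<open>(T ^^ (s * n)) y\<close> are simultaneously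
  near \<open>p\<close> for infinitely many \<open>n\<close>. Both properties hold for the shift on the closed set of
  sequences with prescribed almost periods \<open>4 k!\<close> and prescribed zero blocks. The set contains more
  than the zero sequence because of \<open>inf\<^sub>k max 0 (cos (2 \<pi> n / (4 k!)))\<close>: the \<open>k\<close>-th term has
  period \<open>4 k!\<close> and a zero block of length \<open>2 k!\<close> in each period, whereas the terms
  with \<open>j > k\<close> hardly change under a translation by \<open>4 k!\<close>.\<close>

section \<open>Cosine estimate and criteria for liminf and limsup\<close>

lemma abs_cos_diff_le: "\<bar>cos x - cos y\<bar> \<le> \<bar>x - y\<bar>" for x y :: real
proof -
  have "\<bar>cos x - cos y\<bar> = 2 * \<bar>sin ((x + y) / 2)\<bar> * \<bar>sin ((y - x) / 2)\<bar>"
    by (simp add: cos_diff_cos abs_mult)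
  also have "\<dots> \<le> 2 * 1 * \<bar>(y - x) / 2\<bar>"
    by (intro mult_mono abs_sin_x_le_abs_x) auto
  finally show ?thesis by simp
qed

lemma cos_plus_2pi_nat: "cos (x + 2 * pi * real q) = cos x"
  using cos.plus_of_nat[of x q] by (simp add: mult_ac)

lemma liminf_eq_0I:
  fixes u :: "nat \<Rightarrow> real"
  assumes nonneg: "\<And>n. u n \<ge> 0" and small: "\<And>e N. e > 0 \<Longrightarrow> \<exists>n\<ge>N. u n < e"
  shows "liminf (\<lambda>n. ereal (u n)) = 0"
proof (rule antisym)
  show "0 \<le> liminf (\<lambda>n. ereal (u n))"
    by (intro Liminf_bounded) (simp add: nonneg)
  show "liminf (\<lambda>n. ereal (u n)) \<le> 0"
  proof (rule ccontr)
    assume "\<not> ?thesis"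
    then obtain e where e: "0 < ereal e" "ereal e < liminf (\<lambda>n. ereal (u n))"
      using ereal_dense2 by (metis not_le)
    then have "eventually (\<lambda>n. e < u n) sequentially"
      using less_LiminfD[OF e(2)] by simp
    then obtain N where "\<And>n. n \<ge> N \<Longrightarrow> e < u n"
      unfolding eventually_sequentially by blast
    then show False using small[of e N] e by force
  qed
qed

lemma limsup_pos:
  fixes u :: "nat \<Rightarrow> real"
  assumes "d > 0" and large: "\<And>N. \<exists>n\<ge>N. u n \<ge> d"
  shows "limsup (\<lambda>n. ereal (u n)) > 0"
proof -
  have "ereal d \<le> limsup (\<lambda>n. ereal (u n))"
  proof (rule ccontr)
    assume "\<not> ?thesis"
    then have "eventually (\<lambda>n. u n < d) sequentially"
      using Limsup_lessD[of sequentially "\<lambda>n. ereal (u n)" "ereal d"] by (simp add: not_le)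
    then obtain N where "\<And>n. n \<ge> N \<Longrightarrow> u n < d"
      unfolding eventually_sequentially by blast
    then show False using large[of N] by force
  qed
  then show ?thesis using assms(1) by (metis ereal_less(2) less_le_trans)
qed

section \<open>The shift and the product metric on sequences\<close>

definition shift :: "(nat \<Rightarrow> 'a) \<Rightarrow> nat \<Rightarrow> 'a" where
  "shift h = (\<lambda>n. h (Suc n))"

lemma funpow_shift: "(shift ^^ m) h = (\<lambda>n. h (m + n))"
  by (induction m arbitrary: h) (simp_all add: shift_def funpow_swap1)

lemma continuous_on_shift:
  "continuous_on X (shift :: (nat \<Rightarrow> 'a::topological_space) \<Rightarrow> nat \<Rightarrow> 'a)"
proof -
  have "continuous_on UNIV (shift :: (nat \<Rightarrow> 'a) \<Rightarrow> nat \<Rightarrow> 'a)"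
    unfolding shift_def by (intro continuous_on_coordinatewise_then_product) simp
  then show ?thesis by (rule continuous_on_subset) simp
qed

text \<open>On \<^typ>\<open>nat\<close> too, \<^const>\<open>to_nat\<close> is an unspecified injection, so the weights in
  the metric on sequences are not in the natural order.\<close>

lemma dist_seq_small:
  fixes e :: real
  assumes "e > 0"
  obtains L :: nat where
    "\<And>x y :: nat \<Rightarrow> 'a::metric_space. (\<And>n. n \<le> L \<Longrightarrow> x n = y n) \<Longrightarrow> dist x y < e"
proof -
  obtain N where N: "(1/2) ^ N < e"
    using real_arch_pow_inv[OF assms, of "1/2"] by auto
  \<comment> \<open>The terms of the metric up to index \<open>N\<close> see only the coordinates
    \<open>from_nat n\<close> with \<open>n \<le> N\<close>, which \<open>L\<close> bounds; the
    remaining terms add up to at most \<open>(1/2) ^ N\<close>.\<close>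
  define L where "L = Max ((from_nat :: nat \<Rightarrow> nat) ` {..N})"
  have L: "from_nat n \<le> L" if "n \<le> N" for n
    unfolding L_def using that by (intro Max_ge) auto
  have "dist x y < e" if "\<And>n. n \<le> L \<Longrightarrow> x n = y n" for x y :: "nat \<Rightarrow> 'a"
  proof -
    have "{dist (x (from_nat n)) (y (from_nat n)) |n. n \<le> N} = {0}"
      using that L by (auto intro!: exI[of _ 0])
    then show ?thesis using dist_fun_le_dist_first_terms[of x y N] N by simp
  qed
  then show ?thesis using that by blast
qed

text \<open>The left side is a single term of the series of nonnegative terms that defines the
  metric.\<close>

lemma dist_seq_ge:
  fixes x y :: "nat \<Rightarrow> 'a::metric_space"
  shows "(1/2) ^ to_nat c * min (dist (x c) (y c)) 1 \<le> dist x y"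
proof -
  let ?a = "\<lambda>n. (1/2) ^ n * min (dist (x (from_nat n)) (y (from_nat n))) 1"
  have "summable ?a"
    by (rule summable_comparison_test'[of "\<lambda>n. (1/2) ^ n"]) auto
  then have "sum ?a {to_nat c} \<le> suminf ?a"
    by (intro sum_le_suminf) auto
  then show ?thesis by (simp add: dist_fun_def)
qed

section \<open>The compact shift-invariant set of sequences\<close>

text \<open>The gap \<open>5 * fact k\<close> is one period \<open>4 * fact k\<close> plus the
  quarter period that precedes the zero block of the cosine. Each \<open>i\<close> ranges over a
  finite set, which keeps the condition closed.\<close>

definition rigid_seqs :: "(nat \<Rightarrow> real) set" where
  "rigid_seqs = {h. (\<forall>n. h n \<in> {0..1}) \<and>
    (\<forall>k n. \<bar>h (n + 4 * fact k) - h n\<bar> \<le> 2 * pi / (real k + 1)) \<and>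
    (\<forall>k m. \<exists>i\<in>{..5 * fact k}. \<forall>j\<in>{..fact k}. h (m + i + j) = 0)}"

lemma rigid_seqs_zero_block:
  assumes "h \<in> rigid_seqs"
  obtains a where "m \<le> a" "a \<le> m + 5 * fact k" "\<And>n. a \<le> n \<Longrightarrow> n \<le> a + fact k \<Longrightarrow> h n = 0"
proof -
  obtain i where i: "i \<le> 5 * fact k" "\<And>j. j \<le> fact k \<Longrightarrow> h (m + i + j) = 0"
    using assms unfolding rigid_seqs_def by fastforce
  have "h n = 0" if "m + i \<le> n" "n \<le> m + i + fact k" for n
    using i(2)[of "n - (m + i)"] that by simp
  then show ?thesis using that[of "m + i"] i(1) by auto
qed

text \<open>Telescoping. For fixed \<open>r\<close> the bound tends to 0 as \<open>k\<close> grows,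
  uniformly in \<open>n\<close> and \<open>h\<close>: this is the rigidity of the powers of the
  shift.\<close>

lemma rigid_seqs_almost_period:
  assumes "h \<in> rigid_seqs"
  shows "\<bar>h (n + r * (4 * fact k)) - h n\<bar> \<le> real r * (2 * pi / (real k + 1))"
proof (induction r)
  case (Suc r)
  have "\<bar>h (n + r * (4 * fact k) + 4 * fact k) - h (n + r * (4 * fact k))\<bar> \<le> 2 * pi / (real k + 1)"
    using assms unfolding rigid_seqs_def by blast
  moreover have "n + Suc r * (4 * fact k) = n + r * (4 * fact k) + 4 * fact k"
    by simp
  moreover have "real (Suc r) * (2 * pi / (real k + 1))
      = real r * (2 * pi / (real k + 1)) + 2 * pi / (real k + 1)"
    by (simp add: ring_distribs add_divide_distrib)
  ultimately show ?case
    using Suc abs_triangle_ineq4 by (smt (verit))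
qed simp

lemma closed_Collect_bex:
  assumes "finite A" "\<And>i. i \<in> A \<Longrightarrow> closed {x. P i x}"
  shows "closed {x. \<exists>i\<in>A. P i x}"
proof -
  have "{x. \<exists>i\<in>A. P i x} = (\<Union>i\<in>A. {x. P i x})" by blast
  then show ?thesis using assms by (simp add: closed_UN)
qed

text \<open>A closed subset of the cube \<open>[0,1]^nat\<close>, which is compact by Tychonoff.
  Each condition is an intersection of finite unions of closed conditions on single
  coordinates.\<close>

lemma compact_rigid_seqs: "compact rigid_seqs"
proof -
  have cont: "continuous_on UNIV (\<lambda>h :: nat \<Rightarrow> real. h n)" for n
    by simp
  have "closed rigid_seqs"
    unfolding rigid_seqs_def atLeastAtMost_iff Ball_def
    by (intro closed_Collect_conj closed_Collect_all closed_Collect_bex closed_Collect_imp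
        open_Collect_const closed_Collect_le closed_Collect_eq continuous_intros cont) auto
  moreover have "compact (PiE UNIV (\<lambda>_::nat. {0..1::real}))"
    using compactin_PiE[of "\<lambda>_. euclidean" UNIV "\<lambda>_::nat. {0..1::real}"]
    by (simp add: euclidean_product_topology)
  moreover have "rigid_seqs \<subseteq> PiE UNIV (\<lambda>_. {0..1})"
    by (auto simp: rigid_seqs_def PiE_def)
  ultimately show ?thesis
    by (metis compact_Int_closed inf.absorb2)
qed

lemma shift_rigid_seqs: "shift ` rigid_seqs \<subseteq> rigid_seqs"
proof -
  have "shift h \<in> rigid_seqs" if h: "h \<in> rigid_seqs" for h
  proof -
    have "\<exists>i\<in>{..5 * fact k}. \<forall>j\<in>{..fact k}. h (Suc (m + i + j)) = 0" for k m
    proof -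
      have "\<exists>i\<in>{..5 * fact k}. \<forall>j\<in>{..fact k}. h (Suc m + i + j) = 0"
        using h unfolding rigid_seqs_def by blast
      then show ?thesis by simp
    qed
    moreover have "\<bar>h (Suc (n + 4 * fact k)) - h (Suc n)\<bar> \<le> 2 * pi / (real k + 1)" for k n
    proof -
      have "\<bar>h (Suc n + 4 * fact k) - h (Suc n)\<bar> \<le> 2 * pi / (real k + 1)"
        using h unfolding rigid_seqs_def by blast
      then show ?thesis by simp
    qed
    ultimately show ?thesis
      using h unfolding rigid_seqs_def shift_def by blast
  qed
  then show ?thesis by blast
qed

section \<open>A nonzero member of the set\<close>

definition bump :: "nat \<Rightarrow> nat \<Rightarrow> real" where
  "bump k n = max 0 (cos (2 * pi * real n / (4 * fact k)))"

definition profile :: "nat \<Rightarrow> real" where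
  "profile n = (INF k. bump k n)"

lemma profile_le: "profile n \<le> bump k n"
  unfolding profile_def by (rule cINF_lower) (auto intro!: bdd_belowI[of _ 0] simp: bump_def)

lemma profile_ge: "(\<And>k. c \<le> bump k n) \<Longrightarrow> c \<le> profile n"
  unfolding profile_def by (rule cINF_greatest) auto

text \<open>If \<open>j \<le> k\<close>, then \<open>fact j\<close> divides \<open>fact k\<close>
  and the translation is a multiple of the period. Otherwise the argument of the cosine moves by
  \<open>2 * pi * fact k / fact j\<close>, where \<open>(k + 1) * fact k \<le> fact j\<close>;
  cosine and \<open>max 0\<close> are 1-Lipschitz.\<close>

lemma abs_bump_diff_le: "\<bar>bump j (n + 4 * fact k) - bump j n\<bar> \<le> 2 * pi / (real k + 1)"
proof (cases "j \<le> k")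
  case True
  then obtain q where q: "fact k = fact j * (q :: nat)"
    using fact_dvd[of j k] by (auto elim: dvdE)
  have "real (fact k) = real (fact j) * real q"
    unfolding q by simp
  then have "2 * pi * real (n + 4 * fact k) / (4 * fact j)
      = 2 * pi * real n / (4 * fact j) + 2 * pi * real q"
    by (simp add: field_simps)
  then have "bump j (n + 4 * fact k) = bump j n"
    unfolding bump_def by (simp only: cos_plus_2pi_nat)
  then show ?thesis by simp
next
  case False
  then have "real (fact (Suc k)) \<le> real (fact j)"
    by (intro of_nat_mono fact_mono_nat) simp
  then have fct: "(real k + 1) * fact k \<le> fact j" by (simp add: algebra_simps)
  have "\<bar>bump j (n + 4 * fact k) - bump j n\<bar>
      \<le> \<bar>cos (2 * pi * real (n + 4 * fact k) / (4 * fact j)) - cos (2 * pi * real n / (4 * fact j))\<bar>"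
    unfolding bump_def by linarith
  also have "\<dots> \<le> \<bar>2 * pi * real (n + 4 * fact k) / (4 * fact j) - 2 * pi * real n / (4 * fact j)\<bar>"
    by (rule abs_cos_diff_le)
  also have "\<dots> = 2 * pi * (fact k / fact j)"
    by (simp add: field_simps)
  also have "fact k / fact j \<le> 1 / (real k + 1)"
    using fct by (simp add: field_simps)
  finally show ?thesis by simp
qed

text \<open>Modulo \<open>2 * pi\<close> the argument lies in \<open>[pi/2, 3*pi/2]\<close>, where
  the cosine is nonpositive and gets cut off.\<close>

lemma bump_eq_0:
  assumes "j \<le> 2 * fact k"
  shows "bump k (q * (4 * fact k) + fact k + j) = 0"
proof -
  let ?t = "2 * pi * real j / (4 * fact k)"
  have "real j \<le> 2 * fact k"
    using of_nat_mono[OF assms, where 'a = real] by simp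
  then have t: "0 \<le> ?t" "?t \<le> pi" by (auto simp: field_simps)
  have "2 * pi * real (q * (4 * fact k) + fact k + j) / (4 * fact k)
      = (?t + pi / 2) + 2 * pi * real q"
    by (simp add: field_simps)
  then have "cos (2 * pi * real (q * (4 * fact k) + fact k + j) / (4 * fact k)) = cos (?t + pi / 2)"
    by (simp only: cos_plus_2pi_nat)
  also have "\<dots> = - sin ?t"
    by (simp only: cos_add cos_pi_half sin_pi_half)
  also have "\<dots> \<le> 0" using t by (simp add: sin_ge_zero)
  finally show ?thesis by (simp add: bump_def)
qed

lemma profile_in_rigid_seqs: "profile \<in> rigid_seqs"
proof -
  have nonneg: "0 \<le> profile n" for n
    by (rule profile_ge) (simp add: bump_def)
  have "profile n \<le> 1" for n
    using profile_le[of n 0] cos_le_one by (force simp: bump_def intro: order_trans)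
  moreover have "\<bar>profile (n + 4 * fact k) - profile n\<bar> \<le> 2 * pi / (real k + 1)" for n k
  proof -
    let ?e = "2 * pi / (real k + 1)"
    \<comment> \<open>An infimum inherits a bound on differences that is common to all its
      terms.\<close>
    have "profile n - ?e \<le> bump j (n + 4 * fact k)" "profile (n + 4 * fact k) - ?e \<le> bump j n" for j
      using abs_bump_diff_le[of j n k] profile_le[of n j] profile_le[of "n + 4 * fact k" j]
      by linarith+
    then have "profile n - ?e \<le> profile (n + 4 * fact k)" "profile (n + 4 * fact k) - ?e \<le> profile n"
      by (blast intro: profile_ge)+
    then show ?thesis by linarith
  qed
  moreover have "\<exists>i\<in>{..5 * fact k}. \<forall>j\<in>{..fact k}. profile (m + i + j) = 0" for k m
  proof -
    define p :: nat where "p = 4 * fact k"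
    have p: "p > 0" by (simp add: p_def)
    \<comment> \<open>The first multiple of the period beyond \<open>m\<close>, then a quarter
      period further, where the cosine turns nonpositive.\<close>
    define a where "a = Suc (m div p) * p + fact k"
    have "m \<le> Suc (m div p) * p" "Suc (m div p) * p \<le> m + p"
      using dividend_less_div_times[OF p, of m] div_times_less_eq_dividend[of m p]
      by (auto simp: algebra_simps)
    then have a: "m \<le> a" "a \<le> m + 5 * fact k"
      by (simp_all add: a_def p_def)
    have "profile (a + j) = 0" if "j \<le> fact k" for j
      using bump_eq_0[of j k "Suc (m div p)"] profile_le[of "a + j" k] nonneg[of "a + j"] that
      by (simp add: a_def p_def)
    then show ?thesis using a by (intro bexI[of _ "a - m"]) auto
  qed
  ultimately show ?thesis unfolding rigid_seqs_def using nonneg by auto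
qed

lemma profile_0: "profile 0 = 1"
  by (simp add: profile_def bump_def)

lemma zero_in_rigid_seqs: "(\<lambda>_. 0) \<in> rigid_seqs"
  by (auto simp: rigid_seqs_def)

section \<open>Scrambled pairs and the resulting system\<close>

text \<open>Two scales: a zero block of \<open>x\<close> is taken so long that, while
  \<open>r * n\<close> runs through it, \<open>s * n\<close> is bound to meet a shorter zero block
  of \<open>y\<close>.\<close>

lemma rigid_seqs_common_zeros:
  assumes "x \<in> rigid_seqs" "y \<in> rigid_seqs" "r \<ge> 1" "s \<ge> 1"
  obtains n where "n \<ge> N" "\<And>i. i \<le> L \<Longrightarrow> x (r * n + i) = 0" "\<And>i. i \<le> L \<Longrightarrow> y (s * n + i) = 0"
proof -
  \<comment> \<open>Since \<open>fact k \<ge> k\<close>, the block of \<open>y\<close> has room for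
    rounding up to a multiple of \<open>s\<close> and for the window \<open>L\<close>. Likewise
    \<open>K\<close> adds the rounding to a multiple of \<open>r\<close>, the at most
    \<open>B + 1\<close> steps until \<open>y\<close> reaches its block, and the window.\<close>
  define k where "k = s + L"
  define B :: nat where "B = 5 * fact k"
  define K where "K = r + r * (B + 1) + L"
  obtain a where a: "r * N \<le> a" "\<And>n. a \<le> n \<Longrightarrow> n \<le> a + fact K \<Longrightarrow> x n = 0"
    using rigid_seqs_zero_block[OF assms(1), of "r * N" K] by metis
  have ceil: "\<exists>n. c \<le> d * n \<and> d * n \<le> c + d" if "d \<ge> 1" for c d :: nat
  proof -
    have "c \<le> d * Suc (c div d)" "d * Suc (c div d) \<le> c + d"
      using dividend_less_times_div[of d c] times_div_less_eq_dividend[of d c] that by auto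
    then show ?thesis by blast
  qed
  obtain n0 where n0: "a \<le> r * n0" "r * n0 \<le> a + r"
    using ceil[OF assms(3)] by blast
  have "r * N \<le> r * n0" using a(1) n0(1) by linarith
  then have "N \<le> n0" using assms(3) by simp
  obtain b where b: "s * n0 \<le> b" "b \<le> s * n0 + B" "\<And>n. b \<le> n \<Longrightarrow> n \<le> b + fact k \<Longrightarrow> y n = 0"
    using rigid_seqs_zero_block[OF assms(2), of "s * n0" k] unfolding B_def by metis
  obtain n where n: "b \<le> s * n" "s * n \<le> b + s"
    using ceil[OF assms(4)] by blast
  have "s * n0 \<le> s * n" using b(1) n(1) by linarith
  then have "n0 \<le> n" using assms(4) by simp
  \<comment> \<open>Enlarging \<open>B\<close> to \<open>s * B\<close> makes the bound divisible by
    \<open>s\<close>, so that \<open>s\<close> cancels.\<close>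
  have "B \<le> s * B" using assms(4) by simp
  then have "s * n \<le> s * n0 + s * B + s" using n(2) b(2) by linarith
  then have "s * n \<le> s * (n0 + B + 1)" by (simp add: algebra_simps)
  then have "n \<le> n0 + B + 1" using assms(4) by (simp only: mult_le_cancel1)
  show ?thesis
  proof (rule that)
    show "N \<le> n" using \<open>N \<le> n0\<close> \<open>n0 \<le> n\<close> by simp
  next
    fix i assume i: "i \<le> L"
    have "r * n0 \<le> r * n" "r * n \<le> r * n0 + r * (B + 1)"
      using mult_le_mono2[OF \<open>n0 \<le> n\<close>, of r] mult_le_mono2[OF \<open>n \<le> n0 + B + 1\<close>, of r]
      by (simp_all add: algebra_simps)
    then have "a \<le> r * n + i" "r * n + i \<le> a + K"
      using n0 i unfolding K_def by linarith+
    then show "x (r * n + i) = 0"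
      using fact_ge_self[of K] by (intro a(2)) linarith+
    show "y (s * n + i) = 0"
      using n i fact_ge_self[of k] by (intro b(3)) (simp_all add: k_def)
  qed
qed

text \<open>Common zero windows bring the orbits together; at the times \<open>4 * fact k\<close>
  both are almost back at their distinct starting points.\<close>

lemma scrambled_rigid_seqs:
  assumes x: "x \<in> rigid_seqs" and y: "y \<in> rigid_seqs" and "x \<noteq> y" and r: "r \<ge> 1" and s: "s \<ge> 1"
  shows "scrambled dist shift r s x y"
  unfolding scrambled_def
proof
  show "liminf (\<lambda>n. ereal (dist ((shift ^^ (r * n)) x) ((shift ^^ (s * n)) y))) = 0"
  proof (rule liminf_eq_0I)
    fix e :: real and N assume "e > 0"
    obtain L where L: "\<And>x y :: nat \<Rightarrow> real. (\<And>n. n \<le> L \<Longrightarrow> x n = y n) \<Longrightarrow> dist x y < e"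
      using dist_seq_small[OF \<open>e > 0\<close>] by blast
    obtain n where n: "n \<ge> N" "\<And>i. i \<le> L \<Longrightarrow> x (r * n + i) = 0" "\<And>i. i \<le> L \<Longrightarrow> y (s * n + i) = 0"
      using rigid_seqs_common_zeros[OF x y r s] by metis
    have "dist ((shift ^^ (r * n)) x) ((shift ^^ (s * n)) y) < e"
      by (rule L) (simp add: funpow_shift n)
    then show "\<exists>n\<ge>N. dist ((shift ^^ (r * n)) x) ((shift ^^ (s * n)) y) < e"
      using n(1) by blast
  qed simp
next
  obtain c where c: "x c \<noteq> y c" using \<open>x \<noteq> y\<close> by blast
  \<comment> \<open>Half of the gap at coordinate \<open>c\<close>: perturbations of total size
    below \<open>d\<close> leave a gap of at least \<open>d\<close>.\<close>
  define d where "d = \<bar>x c - y c\<bar> / 2"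
  have d: "d > 0" using c by (simp add: d_def)
  show "limsup (\<lambda>n. ereal (dist ((shift ^^ (r * n)) x) ((shift ^^ (s * n)) y))) > 0"
  proof (rule limsup_pos)
    show "(1/2) ^ to_nat c * min d 1 > 0" using d by simp
  next
    fix N
    define C where "C = real (r + s) * (2 * pi)"
    obtain k0 :: nat where k0: "C / d < real k0" using reals_Archimedean2 by blast
    \<comment> \<open>\<open>k0\<close> makes the total perturbation \<open>C / (k + 1)\<close>
      smaller than \<open>d\<close>; \<open>N\<close> makes the time \<open>4 * fact k\<close> late
      enough.\<close>
    define k where "k = max N k0"
    have "C / d < real k + 1" using k0 by (simp add: k_def)
    then have "C / (real k + 1) < d" using d by (simp add: field_simps)
    moreover have "C / (real k + 1) = real r * (2 * pi / (real k + 1)) + real s * (2 * pi / (real k + 1))"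
      by (simp add: C_def add_divide_distrib ring_distribs)
    ultimately have
      "\<bar>x (c + r * (4 * fact k)) - x c\<bar> + \<bar>y (c + s * (4 * fact k)) - y c\<bar> < d"
      using rigid_seqs_almost_period[OF x, of c r k] rigid_seqs_almost_period[OF y, of c s k] by argo
    then have "d \<le> dist (x (c + r * (4 * fact k))) (y (c + s * (4 * fact k)))"
      unfolding d_def dist_real_def by (smt (verit) field_sum_of_halves)
    then have "(1/2) ^ to_nat c * min d 1
        \<le> (1/2) ^ to_nat c * min (dist (x (c + r * (4 * fact k))) (y (c + s * (4 * fact k)))) 1"
      by (intro mult_left_mono) auto
    also have "\<dots> \<le> dist ((shift ^^ (r * (4 * fact k))) x) ((shift ^^ (s * (4 * fact k))) y)"
      using dist_seq_ge[of c "(shift ^^ (r * (4 * fact k))) x" "(shift ^^ (s * (4 * fact k))) y"]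
      by (simp add: funpow_shift add.commute)
    finally have "(1/2) ^ to_nat c * min d 1
        \<le> dist ((shift ^^ (r * (4 * fact k))) x) ((shift ^^ (s * (4 * fact k))) y)" .
    moreover have "N \<le> 4 * fact k"
      using fact_ge_self[of k] by (simp add: k_def)
    ultimately show "\<exists>n\<ge>N. (1/2) ^ to_nat c * min d 1
        \<le> dist ((shift ^^ (r * n)) x) ((shift ^^ (s * n)) y)"
      by blast
  qed
qed

text \<open>Passes from type-class topology to the set-based notions: \<open>dist\<close> restricted
  to \<open>X\<close> induces the subspace topology.\<close>

lemma dynamical_system_compact_dist:
  fixes X :: "'a::metric_space set"
  assumes "compact X" "continuous_on X T" "T ` X \<subseteq> X"
  shows "dynamical_system X dist T"
proof -
  interpret Submetric UNIV dist X by unfold_locales simp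
  have "sub.mtopology = top_of_set X" by (simp add: mtopology_submetric)
  then show ?thesis
    using assms sub.Metric_space_axioms
    by (auto simp: dynamical_system_def compact_space_subtopology)
qed

theorem theorem6p15:
  shows "\<exists>(X :: (nat \<Rightarrow> real) set) \<rho> T.
           dynamical_system X \<rho> T \<and>
           (\<exists>x\<in>X. \<exists>y\<in>X. x \<noteq> y) \<and>
           (\<forall>x\<in>X. \<forall>y\<in>X. x \<noteq> y \<longrightarrow>
              (\<forall>r s :: nat. r \<ge> 1 \<longrightarrow> s \<ge> 1 \<longrightarrow> scrambled \<rho> T r s x y))"
proof (intro exI conjI)
  show "dynamical_system rigid_seqs dist shift"
    by (intro dynamical_system_compact_dist compact_rigid_seqs continuous_on_shift shift_rigid_seqs)
  have "profile \<noteq> (\<lambda>_. 0)" using profile_0 by (metis zero_neq_one)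
  then show "\<exists>x\<in>rigid_seqs. \<exists>y\<in>rigid_seqs. x \<noteq> y"
    using profile_in_rigid_seqs zero_in_rigid_seqs by blast
qed (blast intro: scrambled_rigid_seqs)

end
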